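(* Let $(M,w)$ and $(M',w')$ be pointed models that are collectively $\mathtt{P}$-bisimilar. Then for every $\psi\in\mathcal{L}^*$, $(M,w)\Vdash\psi$ if and only if $(M',w')\Vdash\psi$.
   Context: Fix a finite non-empty set of agents $A$ and a non-empty countable set of atoms $\mathtt{P}$. A model is $M=\langle W,R,V\rangle$ with $W$ non-empty, $R=\{R_i\subseteq W\times W\mid i\in A\}$ arbitrary relations, $V:\mathtt{P}\to\mathcal{P}(W)$; $R_G:=\bigcap_{k\in G}R_k$ (with $R_\emptyset:=W\times W$). $\mathcal{L}_D$: $\varphi::=p\mid\lnot\varphi\mid\varphi\land\varphi\mid D_G\varphi$ ($\emptyset\neq G\subseteq A$), with $(M,w)\Vdash D_G\varphi$ iff $\varphi$ holds at all $u$ with $(w,u)\in R_G$. $\|\chi\|^M$ is the truth set of $\chi$, $\sim^M_\chi:=(\|\chi\|^M\times\|\chi\|^M)\cup(\|\lnot\chi\|^M\times\|\lnot\chi\|^M)$, and for $S\subseteq A$, $M^{S,\chi}=\langle W,R^{S,\chi},V\rangle$ with $R^{S,\chi}_i:=R_i\cap(R_S\cup\sim^M_\chi)$. The language $\mathcal{L}^*$ is $\bigcup_n\mathcal{L}^{*,n}$, where $\mathcal{L}^{*,0}$ is $\mathcal{L}_D$ extended with formulas $[S]\varphi$ ($S\subseteq A$), and $\mathcal{L}^{*,n+1}$ extends $\mathcal{L}^{*,n}$ with formulas $[S,\chi]\varphi$ for $S\subseteq A$, $\chi\in\mathcal{L}^{*,n}$. Semantics: $(M,w)\Vdash[S,\chi]\varphi$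 iff $(M^{S,\chi},w)\Vdash\varphi$; $(M,w)\Vdash[S]\varphi$ iff $(M^{S,\chi},w)\Vdash\varphi$ for every $\chi\in\mathcal{L}_D$. A collective $\mathtt{P}$-bisimulation between $M$ and $M'=\langle W',R',V'\rangle$ is a non-empty $Z\subseteq W\times W'$ such that each $(u,u')\in Z$ satisfies: same atoms; for every $G\subseteq A$ and $(u,v)\in R_G$ some $v'$ has $(u',v')\in R'_G$, $(v,v')\in Z$; and symmetrically (back). $(M,w),(M',w')$ are collectively $\mathtt{P}$-bisimilar if such $Z$ contains $(w,w')$. *)

theory Defs
  imports Main "HOL-Library.Countable"
begin

text \<open>
  The set of agents is the universe of a type \<open>'a\<close> of class \<open>finite\<close>, the set of atoms the
  universe of a type \<open>'p\<close> of class \<open>countable\<close>; both are non-empty because HOL types are.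
\<close>

record ('a, 'p, 'w) model =
  worlds :: "'w set"
  acc :: "'a \<Rightarrow> ('w \<times> 'w) set"
  val :: "'p \<Rightarrow> 'w set"

definition is_model :: "('a, 'p, 'w) model \<Rightarrow> bool" where
  "is_model M \<longleftrightarrow>
     worlds M \<noteq> {} \<and> (\<forall>i. acc M i \<subseteq> worlds M \<times> worlds M) \<and> (\<forall>p. val M p \<subseteq> worlds M)"

definition pointed_model :: "('a, 'p, 'w) model \<Rightarrow> 'w \<Rightarrow> bool" where
  "pointed_model M w \<longleftrightarrow> is_model M \<and> w \<in> worlds M"

definition group_acc :: "('a, 'p, 'w) model \<Rightarrow> 'a set \<Rightarrow> ('w \<times> 'w) set" where
  "group_acc M G = (if G = {} then worlds M \<times> worlds M else (\<Inter>k\<in>G. acc M k))"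

text \<open>
  Raw formulas. \<open>Comm S \<phi>\<close> is \<open>[S]\<phi>\<close> and \<open>CommOn S \<chi> \<phi>\<close> is \<open>[S,\<chi>]\<phi>\<close>. The restriction to
  non-empty groups in \<open>Dist G \<phi>\<close> is imposed by the languages \<open>LD\<close> and \<open>Lstar\<close> below.
\<close>

datatype ('a, 'p) fm =
    Atom 'p
  | Neg "('a, 'p) fm"
  | Conj "('a, 'p) fm" "('a, 'p) fm"
  | Dist "'a set" "('a, 'p) fm"
  | Comm "'a set" "('a, 'p) fm"
  | CommOn "'a set" "('a, 'p) fm" "('a, 'p) fm"

inductive_set LD :: "('a, 'p) fm set" where
  "Atom p \<in> LD"
| "\<phi> \<in> LD \<Longrightarrow> Neg \<phi> \<in> LD"
| "\<phi> \<in> LD \<Longrightarrow> \<psi> \<in> LD \<Longrightarrow> Conj \<phi> \<psi> \<in> LD"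
| "G \<noteq> {} \<Longrightarrow> \<phi> \<in> LD \<Longrightarrow> Dist G \<phi> \<in> LD"

inductive Lstar_level :: "nat \<Rightarrow> ('a, 'p) fm \<Rightarrow> bool" where
  "Lstar_level n (Atom p)"
| "Lstar_level n \<phi> \<Longrightarrow> Lstar_level n (Neg \<phi>)"
| "Lstar_level n \<phi> \<Longrightarrow> Lstar_level n \<psi> \<Longrightarrow> Lstar_level n (Conj \<phi> \<psi>)"
| "G \<noteq> {} \<Longrightarrow> Lstar_level n \<phi> \<Longrightarrow> Lstar_level n (Dist G \<phi>)"
| "Lstar_level n \<phi> \<Longrightarrow> Lstar_level n (Comm S \<phi>)"
| "Lstar_level n \<chi> \<Longrightarrow> Lstar_level (Suc n) \<phi> \<Longrightarrow> Lstar_level (Suc n) (CommOn S \<chi> \<phi>)"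

definition Lstar :: "('a, 'p) fm set" where
  "Lstar = (\<Union>n. {\<phi>. Lstar_level n \<phi>})"

lemma LD_Lstar_level: "\<phi> \<in> LD \<Longrightarrow> Lstar_level n \<phi>"
  by (induction rule: LD.induct) (auto intro: Lstar_level.intros)

lemma Lstar_level_Suc: "Lstar_level n \<phi> \<Longrightarrow> Lstar_level (Suc n) \<phi>"
  by (induction rule: Lstar_level.induct) (auto intro: Lstar_level.intros)

text \<open>
  \<open>X\<close> plays the role of the truth set of \<open>\<chi>\<close>; on the set of worlds its complement is the truth
  set of \<open>Neg \<chi>\<close>. Taking a set of worlds instead of \<open>\<chi>\<close> lets these operations occur in the
  recursive definition of satisfaction; the versions taking \<open>\<chi>\<close> follow it.
\<close>

definition agree_on :: "('a, 'p, 'w) model \<Rightarrow> 'w set \<Rightarrow> ('w \<times> 'w) set" where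
  "agree_on M X = X \<times> X \<union> (worlds M - X) \<times> (worlds M - X)"

definition restrict_acc ::
  "('a, 'p, 'w) model \<Rightarrow> 'a set \<Rightarrow> 'w set \<Rightarrow> ('a, 'p, 'w) model" where
  "restrict_acc M S X = M\<lparr>acc := \<lambda>i. acc M i \<inter> (group_acc M S \<union> agree_on M X)\<rparr>"

text \<open>
  Satisfaction of \<open>[S]\<phi>\<close> refers to that of all \<open>\<chi> \<in> LD\<close>, which need not be subformulas.
  The recursion is well-founded since such \<open>\<chi>\<close> contain no communication modality.
\<close>

primrec comm_count :: "('a, 'p) fm \<Rightarrow> nat" where
  "comm_count (Atom p) = 0"
| "comm_count (Neg \<phi>) = comm_count \<phi>"
| "comm_count (Conj \<phi> \<psi>) = comm_count \<phi> + comm_count \<psi>"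
| "comm_count (Dist G \<phi>) = comm_count \<phi>"
| "comm_count (Comm S \<phi>) = Suc (comm_count \<phi>)"
| "comm_count (CommOn S \<chi> \<phi>) = Suc (comm_count \<chi> + comm_count \<phi>)"

lemma comm_count_LD: "\<phi> \<in> LD \<Longrightarrow> comm_count \<phi> = 0"
  by (induction rule: LD.induct) auto

function sat :: "('a, 'p, 'w) model \<Rightarrow> 'w \<Rightarrow> ('a, 'p) fm \<Rightarrow> bool" where
  "sat M w (Atom p) \<longleftrightarrow> w \<in> val M p"
| "sat M w (Neg \<phi>) \<longleftrightarrow> \<not> sat M w \<phi>"
| "sat M w (Conj \<phi> \<psi>) \<longleftrightarrow> sat M w \<phi> \<and> sat M w \<psi>"
| "sat M w (Dist G \<phi>) \<longleftrightarrow> (\<forall>u. (w, u) \<in> group_acc M G \<longrightarrow> sat M u \<phi>)"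
| "sat M w (Comm S \<phi>) \<longleftrightarrow>
     (\<forall>\<chi>. \<chi> \<in> LD \<longrightarrow> sat (restrict_acc M S {v \<in> worlds M. sat M v \<chi>}) w \<phi>)"
| "sat M w (CommOn S \<chi> \<phi>) \<longleftrightarrow> sat (restrict_acc M S {v \<in> worlds M. sat M v \<chi>}) w \<phi>"
  by pat_completeness auto
termination
  by (relation "measures [\<lambda>(M, w, \<phi>). comm_count \<phi>, \<lambda>(M, w, \<phi>). size \<phi>]")
    (auto simp: comm_count_LD)

definition truth_set :: "('a, 'p, 'w) model \<Rightarrow> ('a, 'p) fm \<Rightarrow> 'w set" where
  "truth_set M \<chi> = {w \<in> worlds M. sat M w \<chi>}"

definition truth_equiv :: "('a, 'p, 'w) model \<Rightarrow> ('a, 'p) fm \<Rightarrow> ('w \<times> 'w) set" where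
  "truth_equiv M \<chi> =
     truth_set M \<chi> \<times> truth_set M \<chi> \<union> truth_set M (Neg \<chi>) \<times> truth_set M (Neg \<chi>)"

definition comm_update ::
  "('a, 'p, 'w) model \<Rightarrow> 'a set \<Rightarrow> ('a, 'p) fm \<Rightarrow> ('a, 'p, 'w) model" where
  "comm_update M S \<chi> = M\<lparr>acc := \<lambda>i. acc M i \<inter> (group_acc M S \<union> truth_equiv M \<chi>)\<rparr>"

lemma restrict_acc_truth_set:
  "restrict_acc M S {v \<in> worlds M. sat M v \<chi>} = comm_update M S \<chi>"
proof -
  have "truth_set M (Neg \<chi>) = worlds M - truth_set M \<chi>"
    by (auto simp: truth_set_def)
  then show ?thesis
    by (simp add: restrict_acc_def comm_update_def agree_on_def truth_equiv_def truth_set_def)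
qed

lemma sat_Comm: "sat M w (Comm S \<phi>) \<longleftrightarrow> (\<forall>\<chi>\<in>LD. sat (comm_update M S \<chi>) w \<phi>)"
  by (auto simp: restrict_acc_truth_set)

lemma sat_CommOn: "sat M w (CommOn S \<chi> \<phi>) \<longleftrightarrow> sat (comm_update M S \<chi>) w \<phi>"
  by (simp add: restrict_acc_truth_set)

text \<open>The group \<open>G\<close> ranges over all sets of agents, the empty one included.\<close>

definition collective_bisimulation ::
  "('a, 'p, 'w) model \<Rightarrow> ('a, 'p, 'v) model \<Rightarrow> ('w \<times> 'v) set \<Rightarrow> bool" where
  "collective_bisimulation M M' Z \<longleftrightarrow>
     Z \<noteq> {} \<and> Z \<subseteq> worlds M \<times> worlds M' \<and>
     (\<forall>u u'. (u, u') \<in> Z \<longrightarrow>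
        (\<forall>p. u \<in> val M p \<longleftrightarrow> u' \<in> val M' p) \<and>
        (\<forall>G v. (u, v) \<in> group_acc M G \<longrightarrow> (\<exists>v'. (u', v') \<in> group_acc M' G \<and> (v, v') \<in> Z)) \<and>
        (\<forall>G v'. (u', v') \<in> group_acc M' G \<longrightarrow> (\<exists>v. (u, v) \<in> group_acc M G \<and> (v, v') \<in> Z)))"

definition collectively_bisimilar ::
  "('a, 'p, 'w) model \<Rightarrow> 'w \<Rightarrow> ('a, 'p, 'v) model \<Rightarrow> 'v \<Rightarrow> bool" where
  "collectively_bisimilar M w M' w' \<longleftrightarrow>
     (\<exists>Z. collective_bisimulation M M' Z \<and> (w, w') \<in> Z)"

end

theory Submission
  imports Defs
begin

text \<open>
  A collective bisimulation \<open>Z\<close> between two models remains one after both are updated by \<open>S\<close>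
  and sets \<open>X\<close>, \<open>X'\<close> that \<open>Z\<close> cannot tell apart: an updated \<open>G\<close>-step is either a
  \<open>G \<union> S\<close>-step, or a \<open>G\<close>-step between worlds agreeing on \<open>X\<close>, and \<open>Z\<close> matches steps
  of both kinds. Truth invariance follows by induction along the recursion of satisfaction, applied
  to all pairs of models and bisimulations at once; truth sets are the \<open>X\<close>, \<open>X'\<close>.
\<close>

lemma worlds_restrict_acc [simp]: "worlds (restrict_acc M S X) = worlds M"
  and val_restrict_acc [simp]: "val (restrict_acc M S X) = val M"
  by (simp_all add: restrict_acc_def)

text \<open>For non-empty \<open>G\<close> the factor added by the update is the same for every
  agent, so it comes out of the intersection. The empty group keeps the total relation.\<close>

lemma group_acc_restrict_acc:
  "group_acc (restrict_acc M S X) G =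
     (if G = {} then worlds M \<times> worlds M
      else group_acc M G \<inter> (group_acc M S \<union> agree_on M X))"
  by (auto simp: group_acc_def restrict_acc_def)

lemma group_acc_UnI:
  assumes "(u, v) \<in> group_acc M G" and "(u, v) \<in> group_acc M S"
  shows "(u, v) \<in> group_acc M (G \<union> S)"
  using assms by (auto simp: group_acc_def split: if_splits)

text \<open>Membership of \<open>u\<close> and \<open>v\<close> in \<open>worlds M\<close> serves
  the case \<open>G = {}\<close>, where the relation is total on the worlds; \<open>acc\<close> is
  not assumed here to stay inside them.\<close>

lemma group_acc_antimono:
  assumes "(u, v) \<in> group_acc M H" and "G \<subseteq> H" and "u \<in> worlds M" and "v \<in> worlds M"
  shows "(u, v) \<in> group_acc M G"
  using assms by (auto simp: group_acc_def split: if_splits)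

lemma collective_bisimulation_converse:
  assumes "collective_bisimulation M M' Z"
  shows "collective_bisimulation M' M (Z\<inverse>)"
  using assms unfolding collective_bisimulation_def by auto

lemma collective_bisimulation_worlds:
  assumes "collective_bisimulation M M' Z" and "(u, u') \<in> Z"
  shows "u \<in> worlds M" and "u' \<in> worlds M'"
  using assms unfolding collective_bisimulation_def by auto

lemma collective_bisimulation_val:
  assumes "collective_bisimulation M M' Z" and "(u, u') \<in> Z"
  shows "u \<in> val M p \<longleftrightarrow> u' \<in> val M' p"
  using assms unfolding collective_bisimulation_def by blast

lemma collective_bisimulation_forth:
  assumes "collective_bisimulation M M' Z" and "(u, u') \<in> Z" and "(u, v) \<in> group_acc M G"
  obtains v' where "(u', v') \<in> group_acc M' G" and "(v, v') \<in> Z"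
  using assms unfolding collective_bisimulation_def by meson

lemma collective_bisimulation_back:
  assumes "collective_bisimulation M M' Z" and "(u, u') \<in> Z" and "(u', v') \<in> group_acc M' G"
  obtains v where "(u, v) \<in> group_acc M G" and "(v, v') \<in> Z"
  using assms unfolding collective_bisimulation_def by meson

text \<open>Stated for arbitrary sets \<open>X\<close>, \<open>X'\<close> related through
  \<open>Z\<close>, so that exchanging the two models also yields the back clause.\<close>

lemma restrict_acc_forth:
  assumes Z: "collective_bisimulation M M' Z"
    and X: "\<And>u u'. (u, u') \<in> Z \<Longrightarrow> u \<in> X \<longleftrightarrow> u' \<in> X'"
    and uu': "(u, u') \<in> Z"
    and uv: "(u, v) \<in> group_acc (restrict_acc M S X) G"
  shows "\<exists>v'. (u', v') \<in> group_acc (restrict_acc M' S X') G \<and> (v, v') \<in> Z"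
proof (cases "G = {}")
  case True
  then have "(u, v) \<in> group_acc M {}"
    using uv by (simp add: group_acc_restrict_acc group_acc_def)
  then obtain v' where "(u', v') \<in> group_acc M' {}" "(v, v') \<in> Z"
    using collective_bisimulation_forth[OF Z uu'] by blast
  with True show ?thesis
    by (auto simp: group_acc_restrict_acc group_acc_def)
next
  case False
  with uv have G: "(u, v) \<in> group_acc M G"
    and "(u, v) \<in> group_acc M S \<or> (u, v) \<in> agree_on M X"
    by (auto simp: group_acc_restrict_acc)
  from this(2) show ?thesis
  proof
    assume "(u, v) \<in> group_acc M S"
    \<comment> \<open>Matching the \<open>G\<close>-step and the \<open>S\<close>-step separately
      could give two different successors; one step of the joint group gives a single
      \<open>v'\<close> serving both.\<close>
    with G have "(u, v) \<in> group_acc M (G \<union> S)"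
      by (rule group_acc_UnI)
    then obtain v' where v': "(u', v') \<in> group_acc M' (G \<union> S)" "(v, v') \<in> Z"
      using collective_bisimulation_forth[OF Z uu'] by blast
    have "u' \<in> worlds M'" "v' \<in> worlds M'"
      using collective_bisimulation_worlds(2)[OF Z] uu' v'(2) by blast+
    then have "(u', v') \<in> group_acc M' G" "(u', v') \<in> group_acc M' S"
      using group_acc_antimono[OF v'(1)] by blast+
    with False v'(2) show ?thesis
      by (auto simp: group_acc_restrict_acc)
  next
    assume agree: "(u, v) \<in> agree_on M X"
    obtain v' where v': "(u', v') \<in> group_acc M' G" "(v, v') \<in> Z"
      using collective_bisimulation_forth[OF Z uu' G] by blast
    have "u' \<in> worlds M'" "v' \<in> worlds M'"
      using collective_bisimulation_worlds(2)[OF Z] uu' v'(2) by blast+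
    \<comment> \<open>\<open>Z\<close> preserves membership and non-membership in \<open>X\<close>;
      if both worlds lie outside, \<open>agree_on\<close> also asks that they be worlds of
      \<open>M'\<close>.\<close>
    then have "(u', v') \<in> agree_on M' X'"
      using agree X[OF uu'] X[OF v'(2)] by (auto simp: agree_on_def)
    with False v' show ?thesis
      by (auto simp: group_acc_restrict_acc)
  qed
qed

lemma collective_bisimulation_restrict_acc:
  assumes Z: "collective_bisimulation M M' Z"
    and X: "\<And>u u'. (u, u') \<in> Z \<Longrightarrow> u \<in> X \<longleftrightarrow> u' \<in> X'"
  shows "collective_bisimulation (restrict_acc M S X) (restrict_acc M' S X') Z"
  unfolding collective_bisimulation_def worlds_restrict_acc val_restrict_acc
proof (intro conjI allI impI)
  show "Z \<noteq> {}" "Z \<subseteq> worlds M \<times> worlds M'"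
    using Z by (auto simp: collective_bisimulation_def)
next
  fix u u' p
  assume "(u, u') \<in> Z"
  with Z show "u \<in> val M p \<longleftrightarrow> u' \<in> val M' p"
    by (rule collective_bisimulation_val)
next
  fix u u' G v
  assume "(u, u') \<in> Z" and "(u, v) \<in> group_acc (restrict_acc M S X) G"
  with Z X show "\<exists>v'. (u', v') \<in> group_acc (restrict_acc M' S X') G \<and> (v, v') \<in> Z"
    by (rule restrict_acc_forth)
next
  fix u u' G v'
  assume "(u, u') \<in> Z" and step: "(u', v') \<in> group_acc (restrict_acc M' S X') G"
  \<comment> \<open>The back clause is the forth clause for the converse of \<open>Z\<close>, with
    the roles of \<open>X\<close> and \<open>X'\<close> exchanged.\<close>
  then have "(u', u) \<in> Z\<inverse>"
    by simp
  moreover have "a' \<in> X' \<longleftrightarrow> a \<in> X" if "(a', a) \<in> Z\<inverse>" for a' a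
    using X that by blast
  ultimately have "\<exists>v. (u, v) \<in> group_acc (restrict_acc M S X) G \<and> (v', v) \<in> Z\<inverse>"
    using restrict_acc_forth[OF collective_bisimulation_converse[OF Z] _ _ step] by blast
  then show "\<exists>v. (u, v) \<in> group_acc (restrict_acc M S X) G \<and> (v, v') \<in> Z"
    by simp
qed

lemma collective_bisimulation_sat_iff:
  fixes M :: "('a, 'p, 'w) model" and M' :: "('a, 'p, 'v) model"
  assumes "collective_bisimulation M M' Z" and "(w, w') \<in> Z"
  shows "sat M w \<phi> \<longleftrightarrow> sat M' w' \<phi>"
  using assms
\<comment> \<open>\<open>M'\<close> must vary because updates change it along with \<open>M\<close>,
  and \<open>w'\<close> because \<open>Dist\<close> moves to successors. \<open>Z\<close> stays
  fixed: the same relation links the updated models.\<close>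
proof (induction M w \<phi> arbitrary: M' w' rule: sat.induct)
  case (1 M w p)
  then show ?case
    by (simp add: collective_bisimulation_val)
next
  case (2 M w \<phi>)
  then show ?case
    by simp
next
  case (3 M w \<phi> \<psi>)
  then show ?case
    by simp
next
  case (4 M w G \<phi>)
  have IH: "sat M u \<phi> \<longleftrightarrow> sat M' u' \<phi>"
    if "(w, u) \<in> group_acc M G" and "(u, u') \<in> Z" for u u'
    using "4.IH" that "4.prems"(1) by blast
  show ?case
    unfolding sat.simps
  proof (intro iffI allI impI)
    fix u'
    assume all: "\<forall>u. (w, u) \<in> group_acc M G \<longrightarrow> sat M u \<phi>"
      and "(w', u') \<in> group_acc M' G"
    then obtain u where "(w, u) \<in> group_acc M G" "(u, u') \<in> Z"
      using collective_bisimulation_back[OF "4.prems"] by blast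
    with all show "sat M' u' \<phi>"
      by (simp add: IH[symmetric])
  next
    fix u
    assume all: "\<forall>u'. (w', u') \<in> group_acc M' G \<longrightarrow> sat M' u' \<phi>"
      and u: "(w, u) \<in> group_acc M G"
    then obtain u' where "(w', u') \<in> group_acc M' G" "(u, u') \<in> Z"
      using collective_bisimulation_forth[OF "4.prems"] by blast
    with all u show "sat M u \<phi>"
      by (simp add: IH)
  qed
next
  case (5 M w S \<phi>)
  have "sat (restrict_acc M S {v \<in> worlds M. sat M v \<chi>}) w \<phi> \<longleftrightarrow>
      sat (restrict_acc M' S {v \<in> worlds M'. sat M' v \<chi>}) w' \<phi>" if "\<chi> \<in> LD" for \<chi>
  proof -
    have "u \<in> {v \<in> worlds M. sat M v \<chi>} \<longleftrightarrow> u' \<in> {v \<in> worlds M'. sat M' v \<chi>}"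
      if "(u, u') \<in> Z" for u u'
      \<comment> \<open>Here \<chi> need not be a subformula. The hypothesis is available because
        \<open>sat\<close> recurses on every member of \<open>LD\<close>, whose
        \<open>comm_count\<close> of 0 is below that of \<open>Comm S\<close> \<phi>.\<close>
      using "5.IH"(1)[OF \<open>\<chi> \<in> LD\<close> "5.prems"(1) that]
        collective_bisimulation_worlds[OF "5.prems"(1) that] by blast
    with "5.prems"(1) have "collective_bisimulation
        (restrict_acc M S {v \<in> worlds M. sat M v \<chi>})
        (restrict_acc M' S {v \<in> worlds M'. sat M' v \<chi>}) Z"
      by (rule collective_bisimulation_restrict_acc)
    with that show ?thesis
      using "5.prems"(2) by (rule "5.IH"(2))
  qed
  then show ?case
    by simp
next
  case (6 M w S \<chi> \<phi>)
  have "u \<in> {v \<in> worlds M. sat M v \<chi>} \<longleftrightarrow> u' \<in> {v \<in> worlds M'. sat M' v \<chi>}"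
    if "(u, u') \<in> Z" for u u'
    using "6.IH"(1)[OF "6.prems"(1) that]
      collective_bisimulation_worlds[OF "6.prems"(1) that] by blast
  with "6.prems"(1) have "collective_bisimulation
      (restrict_acc M S {v \<in> worlds M. sat M v \<chi>})
      (restrict_acc M' S {v \<in> worlds M'. sat M' v \<chi>}) Z"
    by (rule collective_bisimulation_restrict_acc)
  then show ?case
    unfolding sat.simps using "6.prems"(2) by (rule "6.IH"(2))
qed

theorem theorem4p4:
  fixes M :: "('a::finite, 'p::countable, 'w) model"
    and M' :: "('a, 'p, 'v) model"
    and w :: 'w and w' :: 'v
  assumes "pointed_model M w" and "pointed_model M' w'"
    and "collectively_bisimilar M w M' w'"
  shows "\<forall>\<psi>\<in>Lstar. sat M w \<psi> \<longleftrightarrow> sat M' w' \<psi>"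
proof
  fix \<psi> :: "('a, 'p) fm"
  from assms(3) obtain Z where "collective_bisimulation M M' Z" and "(w, w') \<in> Z"
    unfolding collectively_bisimilar_def by (elim exE conjE)
  then show "sat M w \<psi> \<longleftrightarrow> sat M' w' \<psi>"
    by (rule collective_bisimulation_sat_iff)
qed

end
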